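(* Let $N\geq 2$. For all large enough $\beta>0$ (i.e. there is $\beta_0>0$ such that for every $\beta\ge\beta_0$) there exists a constant $K(\beta)>0$, independent of $\lambda$ and $u$, such that for all $u\in C_{0}^{\infty}(\mathbb{H}^{N})$ and all $\lambda\geq\beta$, $$\frac{\lambda^{2}}{2}\int_{\mathbb{H}^{N}}|\nabla_{\mathbb{H}}u|^{2}e^{-\left(\frac{\rho(x)}{\sinh\rho(x)}\right)^{\frac{N-1}{2}}\frac{\rho^{2}(x)}{\lambda^{2}}}dV_{\mathbb{H}}\geq K(\beta)\inf_{c\in\mathbb{R}}\int_{\mathbb{H}^{N}}|u-c|^{2}e^{-\left(\frac{\rho(x)}{\sinh\rho(x)}\right)^{\frac{N-1}{2}}\frac{\rho^{2}(x)}{\lambda^{2}}}dV_{\mathbb{H}}.$$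
   Context: $\mathbb{H}^{N}$ is the hyperbolic space in the Poincaré ball model: the Euclidean unit ball with Riemannian metric $\left(\frac{2}{1-|x|^{2}}\right)^{2}dx^{2}$, volume element $dV_{\mathbb{H}}=\left(\frac{2}{1-|x|^{2}}\right)^{N}dx$, Riemannian gradient $\nabla_{\mathbb{H}}=\left(\frac{1-|x|^{2}}{2}\right)^{2}\nabla$; $|\nabla_{\mathbb H}u|$ is the Riemannian norm. $\rho(x)=\log\frac{1+|x|}{1-|x|}$ is the hyperbolic distance from $x$ to $0$; $\rho/\sinh\rho$ is read as $1$ at $\rho=0$. Functions are real-valued; $C_0^\infty$ means smooth with compact support. The integrals may take the value $+\infty$ (in particular on the right for some $c$). *)

theory Defs
  imports "HOL-Analysis.Analysis"
begin

text \<open>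
  The hyperbolic space is the Poincare ball: the open unit ball of \<open>real ^ 'n\<close>, covered by a
  single global chart.  Functions on it are total functions on \<open>real ^ 'n\<close> whose values outside
  the ball are never used.
\<close>

abbreviation hyp_ball :: "(real ^ 'n) set"
  where "hyp_ball \<equiv> ball 0 1"

definition partial_deriv :: "'n \<Rightarrow> (real ^ 'n \<Rightarrow> real) \<Rightarrow> real ^ 'n \<Rightarrow> real"
  where "partial_deriv i f x = frechet_derivative f (at x) (axis i 1)"

text \<open>\<open>k\<close> times continuously differentiable; meant for open \<open>S\<close>.\<close>

primrec Ck_on :: "nat \<Rightarrow> (real ^ 'n) set \<Rightarrow> (real ^ 'n \<Rightarrow> real) \<Rightarrow> bool"
  where
    "Ck_on 0 S f \<longleftrightarrow> continuous_on S f"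
  | "Ck_on (Suc k) S f \<longleftrightarrow>
       (\<forall>x\<in>S. f differentiable (at x)) \<and> (\<forall>i. Ck_on k S (partial_deriv i f))"

definition smooth_on :: "(real ^ 'n) set \<Rightarrow> (real ^ 'n \<Rightarrow> real) \<Rightarrow> bool"
  where "smooth_on S f \<longleftrightarrow> (\<forall>k. Ck_on k S f)"

text \<open>
  The closure is taken in \<open>real ^ 'n\<close>; since it has to stay inside the open ball, this is the
  same as compactness of the support relative to the ball.
\<close>

definition hyp_test_functions :: "(real ^ 'n \<Rightarrow> real) set"
  where "hyp_test_functions =
    {u. smooth_on hyp_ball u \<and>
        compact (closure {x \<in> hyp_ball. u x \<noteq> 0}) \<and>
        closure {x \<in> hyp_ball. u x \<noteq> 0} \<subseteq> hyp_ball}"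

definition hyp_metric :: "real ^ 'n \<Rightarrow> real ^ 'n \<Rightarrow> real ^ 'n \<Rightarrow> real"
  where "hyp_metric x v w = (2 / (1 - (norm x)\<^sup>2))\<^sup>2 * (v \<bullet> w)"

definition hyp_norm :: "real ^ 'n \<Rightarrow> real ^ 'n \<Rightarrow> real"
  where "hyp_norm x v = sqrt (hyp_metric x v v)"

definition hyp_grad :: "(real ^ 'n \<Rightarrow> real) \<Rightarrow> real ^ 'n \<Rightarrow> real ^ 'n"
  where "hyp_grad u x = ((1 - (norm x)\<^sup>2) / 2)\<^sup>2 *\<^sub>R (\<chi> i. partial_deriv i u x)"

definition hyp_vol :: "(real ^ 'n) measure"
  where "hyp_vol =
    density (restrict_space lborel hyp_ball)
      (\<lambda>x. ennreal ((2 / (1 - (norm x)\<^sup>2)) ^ CARD('n)))"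

definition hyp_rho :: "real ^ 'n \<Rightarrow> real"
  where "hyp_rho x = ln ((1 + norm x) / (1 - norm x))"

definition rho_over_sinh :: "real \<Rightarrow> real"
  where "rho_over_sinh r = (if r = 0 then 1 else r / sinh r)"

definition hyp_weight :: "real \<Rightarrow> real ^ 'n \<Rightarrow> real"
  where "hyp_weight l x =
    exp (- (rho_over_sinh (hyp_rho x) powr ((real CARD('n) - 1) / 2) * ((hyp_rho x)\<^sup>2 / l\<^sup>2)))"

end

theory Submission
  imports Defs
begin

text \<open>
  The exponent of the weight is bounded, because \<open>sinh \<rho> \<ge> \<rho>^5 / 120\<close> and \<open>(N - 1) / 2 \<ge> 1 / 2\<close>;
  so for \<open>\<lambda> \<ge> 1\<close> the weight lies between two positive constants, and the choice \<open>c = 0\<close> reduces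
  the claim to the Poincare inequality of hyperbolic space.  For the latter, put
  \<open>p = 2 / (1 - |x|\<^sup>2)\<close>, so that \<open>\<nabla>p = p\<^sup>2 x\<close>.  The Euclidean divergence of \<open>p^(N-1) x\<close> is
  \<open>p^N (N / 2 + (N / 2 - 1) |x|\<^sup>2) \<ge> (N / 2) p^N\<close>; integrating it against \<open>u\<^sup>2\<close> by parts and
  absorbing the cross term \<open>2 u p^(N-1) x \<bullet> \<nabla>u\<close> with Young's inequality gives
  \<open>N\<^sup>2 / 16 \<integral> u\<^sup>2 p^N \<le> \<integral> |\<nabla>u|\<^sup>2 p^(N-2)\<close>.
\<close>

section \<open>Integration by parts for compactly supported functions\<close>

text \<open>The open sets \<open>U\<close> and \<open>- S\<close> cover the space, and on
  \<open>- S\<close> the extension vanishes identically.\<close>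

lemma continuous_on_extend_zero:
  fixes g :: "'a::t2_space \<Rightarrow> real"
  assumes "open U" "compact S" "S \<subseteq> U" "continuous_on U g"
    and "\<And>x. x \<in> U - S \<Longrightarrow> g x = 0"
  shows "continuous_on UNIV (\<lambda>x. if x \<in> U then g x else 0)"
proof -
  let ?G = "\<lambda>x. if x \<in> U then g x else 0"
  have "continuous_on U ?G"
    using assms(4) by (rule continuous_on_eq) auto
  moreover have "continuous_on (- S) ?G"
    by (rule continuous_on_eq[of _ "\<lambda>x. 0"]) (use assms(5) in auto)
  moreover have "open (- S)"
    using assms(2) by (simp add: compact_imp_closed open_Compl)
  ultimately have "continuous_on (U \<union> - S) ?G"
    using assms(1) by (intro continuous_on_open_Un)
  moreover have "U \<union> - S = UNIV"
    using assms(3) by auto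
  ultimately show ?thesis
    by simp
qed

lemma integrable_continuous_compact_support:
  fixes g :: "'a::euclidean_space \<Rightarrow> real"
  assumes "compact S" "continuous_on UNIV g" "\<And>x. x \<notin> S \<Longrightarrow> g x = 0"
  shows "integrable lborel g"
proof -
  have "integrable lborel (\<lambda>x. indicator S x *\<^sub>R g x)"
    by (intro borel_integrable_compact assms(1) continuous_on_subset[OF assms(2)]) auto
  moreover have "(\<lambda>x. indicator S x *\<^sub>R g x) = g"
    by (rule ext) (auto simp: indicator_def assms(3))
  ultimately show ?thesis
    by simp
qed

lemma integrable_extend_zero:
  fixes g :: "'a::euclidean_space \<Rightarrow> real"
  assumes "open U" "compact S" "S \<subseteq> U" "continuous_on U g"
    and "\<And>x. x \<in> U - S \<Longrightarrow> g x = 0"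
  shows "integrable lborel (\<lambda>x. if x \<in> U then g x else 0)"
  by (rule integrable_continuous_compact_support[OF assms(2) continuous_on_extend_zero[OF assms]])
    (use assms(5) in auto)

text \<open>By translation invariance of Lebesgue measure every difference quotient of
  \<open>F\<close> in direction \<open>e\<close> has integral zero. Dominated convergence carries
  this over to the derivative.\<close>

lemma integral_directional_derivative_eq_0:
  fixes F :: "'a::euclidean_space \<Rightarrow> real"
  assumes S: "compact S"
    and deriv: "\<And>x. (F has_derivative F' x) (at x)"
    and cont: "continuous_on UNIV (\<lambda>x. F' x e)"
    and zero: "\<And>x. x \<notin> S \<Longrightarrow> F x = 0"
    and zero': "\<And>x. x \<notin> S \<Longrightarrow> F' x e = 0"
  shows "(\<integral>x. F' x e \<partial>lborel) = 0"
proof -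
  \<comment> \<open>A bound on \<open>S\<close> is a global bound, as \<open>F' x e\<close> vanishes
    elsewhere. By the mean value theorem \<open>B\<close> is then a Lipschitz constant for
    \<open>F\<close> along \<open>e\<close>, which bounds all difference quotients.\<close>
  have "compact ((\<lambda>x. F' x e) ` S)"
    using S continuous_on_subset[OF cont] by (intro compact_continuous_image) auto
  then obtain B where "B > 0" and B: "\<forall>y \<in> (\<lambda>x. F' x e) ` S. norm y \<le> B"
    using compact_imp_bounded bounded_pos by blast
  then have B': "\<bar>F' x e\<bar> \<le> B" for x
    using zero'[of x] by (cases "x \<in> S") auto
  obtain R where R: "\<And>x. x \<in> S \<Longrightarrow> norm x \<le> R"
    using compact_imp_bounded[OF S] unfolding bounded_iff by blast
  have line: "((\<lambda>t. F (x + t *\<^sub>R e)) has_real_derivative F' (x + t *\<^sub>R e) e) (at t)" for x t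
  proof -
    have "((\<lambda>t. F (x + t *\<^sub>R e)) has_derivative (\<lambda>s. F' (x + t *\<^sub>R e) (s *\<^sub>R e))) (at t)"
      by (rule has_derivative_compose[of "\<lambda>t. x + t *\<^sub>R e", OF _ deriv])
        (auto intro!: derivative_eq_intros)
    moreover have "F' (x + t *\<^sub>R e) (s *\<^sub>R e) = F' (x + t *\<^sub>R e) e * s" for s
      using linear_scale[OF has_derivative_linear[OF deriv]] by simp
    ultimately show ?thesis
      by (simp add: has_field_derivative_def)
  qed
  have lip: "\<bar>F (x + t *\<^sub>R e) - F x\<bar> \<le> B * t" if t: "t > 0" for x t
  proof -
    obtain z where "F (x + t *\<^sub>R e) - F (x + 0 *\<^sub>R e) = (t - 0) * F' (x + z *\<^sub>R e) e"
      using MVT2[of 0 t "\<lambda>t. F (x + t *\<^sub>R e)" "\<lambda>t. F' (x + t *\<^sub>R e) e"] line t by blast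
    then show ?thesis
      using B'[of "x + z *\<^sub>R e"] t by (simp add: abs_mult mult.commute[of t])
  qed
  have contF: "continuous_on UNIV F"
    using deriv has_derivative_continuous continuous_at_imp_continuous_on by blast
  have intF: "integrable lborel F"
    by (rule integrable_continuous_compact_support[OF S contF zero])
  define t where "t n = 1 / real (Suc n)" for n
  have t: "0 < t n" "t n \<le> 1" for n
    by (auto simp: t_def)
  define q where "q n x = (F (x + t n *\<^sub>R e) - F x) / t n" for n x
  have shift: "integrable lborel (\<lambda>x. F (x + c))" "(\<integral>x. F (x + c) \<partial>lborel) = (\<integral>x. F x \<partial>lborel)" for c
  proof -
    have F: "F \<in> borel_measurable borel"
      by (rule borel_measurable_continuous_onI[OF contF])
    have "integrable (distr lborel borel ((+) c)) F"
      using intF by (simp add: lborel_distr_plus)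
    then show "integrable lborel (\<lambda>x. F (x + c))"
      by (subst (asm) integrable_distr_eq) (auto simp: F add.commute)
    have "(\<integral>x. F x \<partial>lborel) = (\<integral>x. F x \<partial>distr lborel borel ((+) c))"
      by (simp add: lborel_distr_plus)
    also have "\<dots> = (\<integral>x. F (x + c) \<partial>lborel)"
      by (subst integral_distr) (auto simp: F add.commute)
    finally show "(\<integral>x. F (x + c) \<partial>lborel) = (\<integral>x. F x \<partial>lborel)" ..
  qed
  have q0: "(\<integral>x. q n x \<partial>lborel) = 0" for n
    using shift[of "t n *\<^sub>R e"] intF by (simp add: q_def)
  have qm: "q n \<in> borel_measurable lborel" for n
    unfolding q_def using shift(1)[of "t n *\<^sub>R e"] intF
    by (intro borel_measurable_integrable) simp
  have "(\<lambda>n. \<integral>x. q n x \<partial>lborel) \<longlonglongrightarrow> (\<integral>x. F' x e \<partial>lborel)"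
  \<comment> \<open>Since \<open>t n \<le> 1\<close>, a quotient can be nonzero only within distance
    \<open>norm e\<close> of \<open>S\<close>, hence only in this ball.\<close>
  proof (rule integral_dominated_convergence
      [where w = "\<lambda>x. indicator (cball 0 (R + norm e)) x *\<^sub>R B"])
    show "(\<lambda>x. F' x e) \<in> borel_measurable lborel"
      using borel_measurable_continuous_onI[OF cont] by simp
    show "integrable lborel (\<lambda>x::'a. indicator (cball 0 (R + norm e)) x *\<^sub>R B)"
      by (intro borel_integrable_compact) auto
    show "AE x in lborel. (\<lambda>n. q n x) \<longlonglongrightarrow> F' x e"
    proof (rule AE_I2)
      fix x
      have "((\<lambda>h. (F (x + h *\<^sub>R e) - F x) / h) \<longlongrightarrow> F' x e) (at 0)"
        using line[of x 0] by (simp add: DERIV_def)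
      moreover have "filterlim t (at 0) sequentially"
        using t(1) LIMSEQ_inverse_real_of_nat
        by (auto simp: filterlim_at t_def[abs_def] inverse_eq_divide)
      ultimately show "(\<lambda>n. q n x) \<longlonglongrightarrow> F' x e"
        unfolding q_def by (rule filterlim_compose)
    qed
    show "AE x in lborel. norm (q n x) \<le> indicator (cball 0 (R + norm e)) x *\<^sub>R B" for n
    proof (rule AE_I2)
      fix x
      show "norm (q n x) \<le> indicator (cball 0 (R + norm e)) x *\<^sub>R B"
      proof (cases "norm x \<le> R + norm e")
        case True
        then show ?thesis
          using lip[of "t n" x] t[of n] by (simp add: q_def divide_le_eq)
      next
        case False
        have "norm x \<le> norm (x + t n *\<^sub>R e) + t n * norm e"
          using norm_triangle_ineq4[of "x + t n *\<^sub>R e" "t n *\<^sub>R e"] t(1)[of n] by simp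
        moreover have "t n * norm e \<le> norm e"
          using t[of n] by (simp add: mult_left_le_one_le)
        ultimately have "x \<notin> S" "x + t n *\<^sub>R e \<notin> S"
          using False R[of x] R[of "x + t n *\<^sub>R e"] norm_ge_zero[of e] by linarith+
        then show ?thesis
          using \<open>B > 0\<close> by (simp add: q_def zero)
      qed
    qed
  qed (use qm in auto)
  then show ?thesis
    by (simp add: q0 LIMSEQ_const_iff)
qed

text \<open>Serves functions that are controlled on \<open>U\<close> only. Their extension by zero
  is differentiable everywhere: a point outside \<open>U\<close> lies in the open set
  \<open>- S\<close>, where the extension is constantly zero.\<close>

lemma integral_directional_derivative_extend_zero:
  fixes f :: "'a::euclidean_space \<Rightarrow> real"
  assumes U: "open U" and S: "compact S" "S \<subseteq> U"
    and deriv: "\<And>x. x \<in> U \<Longrightarrow> (f has_derivative f' x) (at x)"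
    and cont: "continuous_on U (\<lambda>x. f' x e)"
    and zero: "\<And>x. x \<in> U - S \<Longrightarrow> f x = 0"
  shows "integrable lborel (\<lambda>x. if x \<in> U then f' x e else 0)" (is ?int)
    and "(\<integral>x. (if x \<in> U then f' x e else 0) \<partial>lborel) = 0" (is ?eq)
proof -
  let ?F = "\<lambda>x. if x \<in> U then f x else 0"
  let ?F' = "\<lambda>x y. if x \<in> U then f' x y else 0"
  have oS: "open (- S)"
    using S by (simp add: compact_imp_closed open_Compl)
  have zero': "f' x y = 0" if "x \<in> U - S" for x y
  proof -
    have "(f has_derivative (\<lambda>_. 0)) (at x)"
      by (rule has_derivative_transform_within_open[where s = "U \<inter> - S" and f = "\<lambda>_. 0"])
        (use U oS that zero in auto)
    with deriv[of x] that have "f' x = (\<lambda>_. 0)"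
      using has_derivative_unique by blast
    then show ?thesis
      by simp
  qed
  show ?int
    by (rule integrable_extend_zero[OF U S cont zero'])
  have "(?F has_derivative ?F' x) (at x)" for x
  proof (cases "x \<in> U")
    case True
    then show ?thesis
      using has_derivative_transform_within_open[OF deriv[OF True] U True, of ?F] by simp
  next
    case False
    have "(?F has_derivative (\<lambda>_. 0)) (at x)"
      by (rule has_derivative_transform_within_open[where s = "- S" and f = "\<lambda>_. 0"])
        (use U oS S False zero in auto)
    then show ?thesis
      using False by simp
  qed
  then show ?eq
    by (rule integral_directional_derivative_eq_0[OF S(1), where F = ?F])
      (use continuous_on_extend_zero[OF U S cont zero'] zero zero' in auto)
qed

text \<open>The integrand is the divergence of the vector field \<open>f x *\<^sub>R x\<close>. Its
  component along \<open>b\<close> is \<open>(x \<bullet> b) * f x\<close>; the derivative of this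
  in direction \<open>b\<close> integrates to zero, and summing over \<open>Basis\<close> gives the
  claim.\<close>

lemma integral_divergence_radial_eq_0:
  fixes f :: "'a::euclidean_space \<Rightarrow> real"
  assumes U: "open U" and S: "compact S" "S \<subseteq> U"
    and deriv: "\<And>x. x \<in> U \<Longrightarrow> (f has_derivative f' x) (at x)"
    and cont: "\<And>b. b \<in> Basis \<Longrightarrow> continuous_on U (\<lambda>x. f' x b)"
    and zero: "\<And>x. x \<in> U - S \<Longrightarrow> f x = 0"
  shows "integrable lborel (\<lambda>x. if x \<in> U then DIM('a) * f x + f' x x else 0)" (is "integrable _ ?D")
    and "(\<integral>x. (if x \<in> U then DIM('a) * f x + f' x x else 0) \<partial>lborel) = 0"
proof -
  have contf: "continuous_on U f"
    using deriv by (meson has_derivative_continuous continuous_at_imp_continuous_on)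
  define g where "g b x = (if x \<in> U then f x + (x \<bullet> b) * f' x b else 0)" for b x
  have g: "integrable lborel (g b)" "(\<integral>x. g b x \<partial>lborel) = 0" if b: "b \<in> Basis" for b
  proof -
    let ?h = "\<lambda>x. (x \<bullet> b) * f x"
    let ?h' = "\<lambda>x y. (x \<bullet> b) * f' x y + (y \<bullet> b) * f x"
    have "(?h has_derivative ?h' x) (at x)" if "x \<in> U" for x
      using deriv[OF that] by (auto intro!: derivative_eq_intros)
    moreover have "continuous_on U (\<lambda>x. ?h' x b)"
      by (intro continuous_intros cont contf b)
    moreover have "(if x \<in> U then ?h' x b else 0) = g b x" for x
      using b by (simp add: g_def)
    ultimately show "integrable lborel (g b)" "(\<integral>x. g b x \<partial>lborel) = 0"
      using integral_directional_derivative_extend_zero[OF U S, of ?h ?h' b] zero by auto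
  qed
  have sum: "?D = (\<lambda>x. \<Sum>b\<in>Basis. g b x)"
  proof
    fix x
    show "?D x = (\<Sum>b\<in>Basis. g b x)"
    proof (cases "x \<in> U")
      case True
      then interpret linear "f' x"
        using deriv has_derivative_linear by blast
      have "f' x x = f' x (\<Sum>b\<in>Basis. (x \<bullet> b) *\<^sub>R b)"
        by (simp add: euclidean_representation)
      also have "\<dots> = (\<Sum>b\<in>Basis. (x \<bullet> b) * f' x b)"
        by (simp add: sum scale)
      finally show ?thesis
        using True by (simp add: g_def sum.distrib)
    qed (simp add: g_def)
  qed
  show "integrable lborel ?D" "(\<integral>x. ?D x \<partial>lborel) = 0"
    unfolding sum using g by simp_all
qed

section \<open>The Poincare inequality of hyperbolic space\<close>

text \<open>The conformal factor: the hyperbolic metric is its square times the Euclidean one, and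
  the volume density is its power with exponent the dimension.\<close>

definition conf_factor :: "real ^ 'n \<Rightarrow> real"
  where "conf_factor x = 2 / (1 - (norm x)\<^sup>2)"

lemma norm_square_less_1: "x \<in> hyp_ball \<Longrightarrow> (norm x)\<^sup>2 < 1"
  by (simp add: power_less_one_iff abs_square_less_1)

lemma conf_factor_pos: "x \<in> hyp_ball \<Longrightarrow> conf_factor x > 0"
  using norm_square_less_1[of x] by (simp add: conf_factor_def)

lemma conf_factor_power_nonneg: "x \<in> hyp_ball \<Longrightarrow> conf_factor x ^ k \<ge> 0"
  using conf_factor_pos[of x] by simp

lemma conf_factor_has_derivative:
  assumes "x \<in> hyp_ball"
  shows "(conf_factor has_derivative (\<lambda>y. (conf_factor x)\<^sup>2 * (x \<bullet> y))) (at x)"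
proof -
  have "1 - x \<bullet> x \<noteq> 0"
    using norm_square_less_1[OF assms] by (simp add: power2_norm_eq_inner)
  then show ?thesis
    unfolding conf_factor_def[abs_def] power2_norm_eq_inner
    by (auto intro!: derivative_eq_intros
        simp: inner_commute power2_eq_square field_simps)
qed

lemma continuous_on_conf_factor: "continuous_on hyp_ball conf_factor"
  by (meson conf_factor_has_derivative has_derivative_continuous continuous_at_imp_continuous_on)

text \<open>Linearity and expansion in the axis vectors; this identifies the vector of partial
  derivatives in \<open>hyp_grad\<close> with the Euclidean gradient.\<close>

lemma frechet_derivative_partial_deriv:
  fixes f :: "real ^ 'n \<Rightarrow> real"
  assumes "f differentiable (at x)"
  shows "frechet_derivative f (at x) y = y \<bullet> (\<chi> i. partial_deriv i f x)"
proof -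
  interpret linear "frechet_derivative f (at x)"
    using assms by (rule linear_frechet_derivative)
  have "frechet_derivative f (at x) y = frechet_derivative f (at x) (\<Sum>i\<in>UNIV. (y $ i) *\<^sub>R axis i 1)"
    by (simp add: basis_expansion flip: scalar_mult_eq_scaleR)
  also have "\<dots> = (\<Sum>i\<in>UNIV. (y $ i) * partial_deriv i f x)"
    by (simp add: sum scale partial_deriv_def)
  finally show ?thesis
    by (simp add: inner_vec_def)
qed

lemma young_ineq:
  fixes a b c :: real
  assumes "c > 0"
  shows "2 * a * b \<le> c * a\<^sup>2 + b\<^sup>2 / c"
proof -
  have "0 \<le> (c * a - b)\<^sup>2 / c"
    using assms by simp
  also have "\<dots> = c * a\<^sup>2 + b\<^sup>2 / c - 2 * a * b"
    using assms by (simp add: field_simps power2_eq_square)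
  finally show ?thesis
    by simp
qed

text \<open>The hyperbolic gradient is the Euclidean one divided by the squared conformal factor,
  while the Riemannian norm multiplies by that factor once.\<close>

lemma hyp_grad_norm_square:
  assumes "x \<in> hyp_ball"
  shows "(hyp_norm x (hyp_grad u x))\<^sup>2 = (norm (\<chi> i. partial_deriv i u x))\<^sup>2 / (conf_factor x)\<^sup>2"
proof -
  let ?g = "\<chi> i. partial_deriv i u x" and ?p = "conf_factor x"
  have "hyp_metric x v v = ?p\<^sup>2 * (norm v)\<^sup>2" for v
    by (simp add: hyp_metric_def conf_factor_def power2_norm_eq_inner)
  then have "(hyp_norm x (hyp_grad u x))\<^sup>2 = ?p\<^sup>2 * (norm (hyp_grad u x))\<^sup>2"
    by (simp add: hyp_norm_def)
  moreover have "hyp_grad u x = (1 / ?p)\<^sup>2 *\<^sub>R ?g"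
    by (simp add: hyp_grad_def conf_factor_def)
  ultimately show ?thesis
    using conf_factor_pos[OF assms] by (simp add: power_mult_distrib power2_eq_square)
qed

text \<open>Both sides are Lebesgue integrals of continuous, compactly supported functions extended
  by zero. The estimate integrates the pointwise bound \<open>main\<close>, in which the divergence
  \<open>D\<close> has integral zero.\<close>

lemma hyperbolic_poincare:
  fixes u :: "real ^ 'n \<Rightarrow> real"
  assumes N: "CARD('n) \<ge> 2" and u: "u \<in> hyp_test_functions"
  defines "N \<equiv> CARD('n)"
  defines "A \<equiv> \<lambda>x. if x \<in> hyp_ball then (u x)\<^sup>2 * conf_factor x ^ N else 0"
    and "B \<equiv> \<lambda>x. if x \<in> hyp_ball
      then (hyp_norm x (hyp_grad u x))\<^sup>2 * conf_factor x ^ N else 0"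
  shows "integrable lborel A" "integrable lborel B"
    and "(real N)\<^sup>2 / 16 * (\<integral>x. A x \<partial>lborel) \<le> (\<integral>x. B x \<partial>lborel)"
proof -
  define S where "S = closure {x \<in> hyp_ball. u x \<noteq> 0}"
  have S: "compact S" "S \<subseteq> hyp_ball"
    using u by (auto simp: hyp_test_functions_def S_def)
  have u0: "u x = 0" if "x \<in> hyp_ball - S" for x
    using that closure_subset[of "{x \<in> hyp_ball. u x \<noteq> 0}"] by (auto simp: S_def)
  have C1: "Ck_on (Suc 0) hyp_ball u"
    using u by (simp add: hyp_test_functions_def smooth_on_def del: Ck_on.simps)
  have diff: "u differentiable (at x)" if "x \<in> hyp_ball" for x
    using C1 that by auto
  have cpart: "continuous_on hyp_ball (partial_deriv i u)" for i
    using C1 by auto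
  define g where "g x = (\<chi> i. partial_deriv i u x)" for x
  have cg: "continuous_on hyp_ball g"
    unfolding g_def by (intro continuous_on_vec_lambda cpart)
  have du: "(u has_derivative (\<lambda>y. y \<bullet> g x)) (at x)" if "x \<in> hyp_ball" for x
    using diff[OF that] frechet_derivative_partial_deriv[OF diff[OF that], abs_def]
    unfolding frechet_derivative_works by (simp add: g_def)
  have cu: "continuous_on hyp_ball u"
    using du by (meson has_derivative_continuous continuous_at_imp_continuous_on)
  have g0: "g x = 0" if "x \<in> hyp_ball - S" for x
  proof -
    have "(u has_derivative (\<lambda>_. 0)) (at x)"
      by (rule has_derivative_transform_within_open[where s = "hyp_ball \<inter> - S" and f = "\<lambda>_. 0"])
        (use S that u0 in \<open>auto simp: compact_imp_closed open_Compl open_Int\<close>)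
    with du[of x] that have "(\<lambda>y. y \<bullet> g x) = (\<lambda>_. 0)"
      using has_derivative_unique by blast
    then show ?thesis
      by (metis inner_eq_zero_iff)
  qed
  have Beq: "B = (\<lambda>x. if x \<in> hyp_ball then (norm (g x))\<^sup>2 / (conf_factor x)\<^sup>2 * conf_factor x ^ N else 0)"
    by (auto simp: B_def hyp_grad_norm_square g_def)
  note cont = continuous_on_conf_factor cu cg
  show iA: "integrable lborel A"
    unfolding A_def
    by (rule integrable_extend_zero[OF open_ball S]) (auto intro!: continuous_intros cont simp: u0)
  show iB: "integrable lborel B"
    unfolding Beq
    by (rule integrable_extend_zero[OF open_ball S])
      (auto intro!: continuous_intros cont simp: g0 dest: conf_factor_pos)
  \<comment> \<open>Writes the exponents \<open>N - 1\<close> and \<open>N - 2\<close> as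
    \<open>Suc m\<close> and \<open>m\<close>, free of truncated subtraction.\<close>
  obtain m where m: "N = Suc (Suc m)"
    using N by (metis N_def Suc_le_D numeral_2_eq_2 Suc_le_mono)
  define p where "p = (conf_factor :: real ^ 'n \<Rightarrow> real)"
  define f where "f x = (u x)\<^sup>2 * p x ^ Suc m" for x
  \<comment> \<open>Product rule, using that the gradient of \<open>p\<close> at \<open>x\<close> is
    \<open>(p x)\<^sup>2 *\<^sub>R x\<close>.\<close>
  define f' where "f' x y = 2 * u x * (y \<bullet> g x) * p x ^ Suc m
    + (u x)\<^sup>2 * (real (Suc m) * p x ^ m * ((p x)\<^sup>2 * (x \<bullet> y)))" for x y
  define D where "D x = (if x \<in> hyp_ball then DIM(real ^ 'n) * f x + f' x x else 0)" for x
  have "(f has_derivative f' x) (at x)" if "x \<in> hyp_ball" for x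
  proof -
    have dp: "((\<lambda>x. p x ^ Suc m) has_derivative (\<lambda>y. real (Suc m) * ((p x)\<^sup>2 * (x \<bullet> y)) * p x ^ m)) (at x)"
      using has_derivative_power[OF conf_factor_has_derivative[OF that], of "Suc m"]
      by (simp only: p_def diff_Suc_1)
    have du2: "((\<lambda>x. (u x)\<^sup>2) has_derivative (\<lambda>y. 2 * u x * (y \<bullet> g x))) (at x)"
      using has_derivative_power[OF du[OF that], of 2] by (simp add: mult_ac)
    show ?thesis
      unfolding f_def
      by (rule has_derivative_eq_rhs[OF has_derivative_mult[OF du2 dp]])
        (simp add: f'_def fun_eq_iff algebra_simps)
  qed
  moreover have "continuous_on hyp_ball (\<lambda>x. f' x b)" for b
    unfolding f'_def p_def by (intro continuous_intros cont)
  moreover have "f x = 0" if "x \<in> hyp_ball - S" for x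
    using u0[OF that] by (simp add: f_def)
  ultimately have iD: "integrable lborel D" and D0: "(\<integral>x. D x \<partial>lborel) = 0"
    unfolding D_def[abs_def] by (intro integral_divergence_radial_eq_0[OF open_ball S]; blast)+
  have main: "N / 4 * A x \<le> D x + 4 / N * B x" for x
  proof (cases "x \<in> hyp_ball")
    case True
    have p: "p x > 0"
      using conf_factor_pos[OF True] by (simp add: p_def)
    have p1: "p x * (1 - (norm x)\<^sup>2) = 2"
      using norm_square_less_1[OF True] by (simp add: p_def conf_factor_def field_simps)
    \<comment> \<open>By \<open>p1\<close> the term \<open>N * f x\<close> contributes the
      coefficient \<open>N / 2 - N / 2 * (norm x)\<^sup>2\<close>. The radial derivative of
      \<open>p x ^ Suc m\<close> adds \<open>(N - 1) * (norm x)\<^sup>2\<close>, and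
      \<open>N - 1 - N / 2 = m / 2\<close>.\<close>
    have D: "D x = (u x)\<^sup>2 * p x ^ N * (N / 2 + m / 2 * (norm x)\<^sup>2)
      + 2 * u x * (x \<bullet> g x) * p x ^ Suc m"
    proof -
      have "N * (u x)\<^sup>2 * p x ^ Suc m = N * (u x)\<^sup>2 * p x ^ Suc m * (p x * (1 - (norm x)\<^sup>2) / 2)"
        by (simp add: p1)
      also have "\<dots> = (u x)\<^sup>2 * p x ^ N * (N / 2 - N / 2 * (norm x)\<^sup>2)"
        by (simp add: m field_simps)
      finally have "N * f x = (u x)\<^sup>2 * p x ^ N * (N / 2 - N / 2 * (norm x)\<^sup>2)"
        by (simp add: f_def)
      moreover have "D x = N * f x + f' x x"
        using True by (simp add: D_def N_def)
      ultimately show ?thesis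
        by (simp add: f'_def m dot_square_norm power2_eq_square field_simps)
    qed
    have "\<bar>x \<bullet> g x\<bar> \<le> norm x * norm (g x)"
      by (rule Cauchy_Schwarz_ineq2)
    also have "\<dots> \<le> norm (g x)"
      using True by (simp add: mult_left_le_one_le)
    finally have "\<bar>x \<bullet> g x\<bar>\<^sup>2 \<le> (norm (g x))\<^sup>2"
      by (intro power_mono) auto
    then have xg: "(x \<bullet> g x)\<^sup>2 \<le> (norm (g x))\<^sup>2"
      by simp
    \<comment> \<open>The choice \<open>c = N / 4\<close> spends half of the available coefficient
      \<open>N / 2\<close> on the cross term and leaves \<open>N / 4\<close> for
      \<open>A\<close>.\<close>
    have "2 * u x * (- ((x \<bullet> g x) / p x))
      \<le> N / 4 * (u x)\<^sup>2 + (- ((x \<bullet> g x) / p x))\<^sup>2 / (N / 4)"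
      by (rule young_ineq) (simp add: m)
    also have "\<dots> \<le> N / 4 * (u x)\<^sup>2 + (norm (g x))\<^sup>2 / (p x)\<^sup>2 / (N / 4)"
      using xg by (intro add_mono divide_right_mono) (auto simp: power_divide divide_right_mono)
    finally have "2 * u x * (- ((x \<bullet> g x) / p x)) * p x ^ N
      \<le> (N / 4 * (u x)\<^sup>2 + (norm (g x))\<^sup>2 / (p x)\<^sup>2 / (N / 4)) * p x ^ N"
      using p by (intro mult_right_mono) auto
    moreover have "2 * u x * (- ((x \<bullet> g x) / p x)) * p x ^ N = - (2 * u x * (x \<bullet> g x) * p x ^ Suc m)"
      using p by (simp add: m)
    moreover have "(u x)\<^sup>2 * p x ^ N * (N / 2) \<le> (u x)\<^sup>2 * p x ^ N * (N / 2 + m / 2 * (norm x)\<^sup>2)"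
      using p by (intro mult_left_mono) auto
    moreover have "(N / 4 * (u x)\<^sup>2 + (norm (g x))\<^sup>2 / (p x)\<^sup>2 / (N / 4)) * p x ^ N
      = N / 4 * A x + 4 / N * B x"
      using True by (simp add: Beq A_def p_def algebra_simps)
    moreover have "(u x)\<^sup>2 * p x ^ N * (N / 2) = N / 4 * A x + N / 4 * A x"
      using True by (simp add: A_def p_def)
    ultimately show ?thesis
      unfolding D by linarith
  qed (simp add: A_def B_def D_def)
  have "(\<integral>x. N / 4 * A x \<partial>lborel) \<le> (\<integral>x. D x + 4 / N * B x \<partial>lborel)"
    using iA iB iD main by (intro integral_mono) auto
  then have "N / 4 * (\<integral>x. A x \<partial>lborel) \<le> 4 / N * (\<integral>x. B x \<partial>lborel)"
    using iA iB iD D0 by simp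
  then show "(real N)\<^sup>2 / 16 * (\<integral>x. A x \<partial>lborel) \<le> (\<integral>x. B x \<partial>lborel)"
    by (simp add: m field_simps power2_eq_square)
qed

section \<open>Passage from the hyperbolic volume to Lebesgue measure\<close>

lemma nn_integral_hyp_vol:
  fixes f :: "real ^ 'n \<Rightarrow> real"
  assumes nonneg: "\<And>x. x \<in> hyp_ball \<Longrightarrow> f x \<ge> 0"
    and int: "integrable lborel (\<lambda>x. if x \<in> hyp_ball then f x * conf_factor x ^ CARD('n) else 0)"
      (is "integrable _ ?F")
  shows "(\<integral>\<^sup>+ x. ennreal (f x) \<partial>hyp_vol)
    = ennreal (\<integral>x. (if x \<in> hyp_ball then f x * conf_factor x ^ CARD('n) else 0) \<partial>lborel)"
proof -
  let ?R = "restrict_space lborel hyp_ball"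
  have cm: "(conf_factor :: real ^ 'n \<Rightarrow> real) \<in> borel_measurable ?R"
    unfolding conf_factor_def[abs_def] by (intro measurable_restrict_space1) measurable
  have "(\<lambda>x. ?F x) \<in> borel_measurable ?R"
    using int by (intro measurable_restrict_space1) auto
  \<comment> \<open>Measurability of \<open>f\<close> on the ball is recovered from that of
    \<open>?F\<close> by dividing by the positive density.\<close>
  then have "(\<lambda>x. ?F x / conf_factor x ^ CARD('n)) \<in> borel_measurable ?R"
    using cm by measurable
  moreover have "?F x / conf_factor x ^ CARD('n) = f x" if "x \<in> space ?R" for x
    using that conf_factor_pos[of x] by (simp add: space_restrict_space)
  ultimately have fm: "f \<in> borel_measurable ?R"
    by (rule measurable_cong[THEN iffD1, rotated])
  have "(\<integral>\<^sup>+ x. ennreal (f x) \<partial>hyp_vol)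
      = (\<integral>\<^sup>+ x. ennreal (conf_factor x ^ CARD('n)) * ennreal (f x) \<partial>?R)"
    unfolding hyp_vol_def conf_factor_def[symmetric]
    using cm fm by (intro nn_integral_density) auto
  also have "\<dots> = (\<integral>\<^sup>+ x. ennreal (conf_factor x ^ CARD('n)) * ennreal (f x)
      * indicator hyp_ball x \<partial>lborel)"
    by (intro nn_integral_restrict_space) auto
  also have "\<dots> = (\<integral>\<^sup>+ x. ennreal (?F x) \<partial>lborel)"
    by (intro nn_integral_cong)
      (auto simp: ennreal_mult[OF conf_factor_power_nonneg nonneg] mult.commute[of "f _"])
  also have "\<dots> = ennreal (\<integral>x. ?F x \<partial>lborel)"
    using int nonneg conf_factor_power_nonneg by (intro nn_integral_eq_integral) (auto intro!: AE_I2 mult_nonneg_nonneg)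
  finally show ?thesis .
qed

section \<open>Bounds on the weight\<close>

text \<open>For nonnegative \<open>r\<close> all terms of the power series are nonnegative, so a
  single one bounds the sum from below.\<close>

lemma sinh_ge_odd_term:
  fixes r :: real
  assumes "r \<ge> 0" "odd k"
  shows "r ^ k / fact k \<le> sinh r"
proof -
  let ?a = "\<lambda>n. if even n then 0 else r ^ n /\<^sub>R fact n"
  have "sum ?a {k} \<le> suminf ?a"
    using assms by (intro sum_le_suminf sums_summable[OF sinh_converges]) auto
  also have "suminf ?a = sinh r"
    by (rule sums_unique[OF sinh_converges, symmetric])
  finally show ?thesis
    using assms by (simp add: divide_inverse mult.commute)
qed

text \<open>For \<open>r > 0\<close> the quotient \<open>q = r / sinh r\<close> lies in
  \<open>(0, 1]\<close>, so \<open>q powr a \<le> sqrt q\<close>. The square of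
  \<open>sqrt q * r\<^sup>2\<close> is \<open>r ^ 5 / sinh r\<close>, bounded through the
  fifth-order term of \<open>sinh\<close>.\<close>

lemma rho_over_sinh_powr_bound:
  assumes r: "r \<ge> 0" and a: "a \<ge> 1 / 2"
  shows "rho_over_sinh r powr a * r\<^sup>2 \<le> 11"
proof (cases "r = 0")
  case False
  with r have r: "r > 0"
    by simp
  let ?q = "rho_over_sinh r"
  have s: "sinh r > 0"
    using r by simp
  have q: "?q = r / sinh r"
    using r by (simp add: rho_over_sinh_def)
  have q1: "0 < ?q" "?q \<le> 1"
    using sinh_ge_odd_term[of r 1] r s by (auto simp: q)
  have "r ^ 5 \<le> 120 * sinh r"
    using sinh_ge_odd_term[of r 5] r by (simp add: fact_numeral)
  \<comment> \<open>Rounds 120 up to the perfect square 121, so that the root is 11.\<close>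
  with s have "r ^ 5 \<le> 121 * sinh r"
    by linarith
  then have "?q * r ^ 4 \<le> 121"
    using s by (simp add: q power_numeral_reduce field_simps)
  moreover have "(sqrt ?q * r\<^sup>2)\<^sup>2 = ?q * r ^ 4"
    using q1 by (simp add: power_mult_distrib)
  ultimately have "(sqrt ?q * r\<^sup>2)\<^sup>2 \<le> 11\<^sup>2"
    by simp
  then have "sqrt ?q * r\<^sup>2 \<le> 11"
    by (rule power2_le_imp_le) simp
  moreover have "?q powr a \<le> ?q powr (1 / 2)"
    using q1 a by (intro powr_mono') auto
  then have "?q powr a * r\<^sup>2 \<le> sqrt ?q * r\<^sup>2"
    using q1 by (intro mult_right_mono) (auto simp: powr_half_sqrt)
  ultimately show ?thesis
    by linarith
qed simp

lemma hyp_weight_le_1: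
  "hyp_weight l x \<le> 1"
  by (simp add: hyp_weight_def)

text \<open>Dimension at least 2 makes the power in the exponent at least \<open>1 / 2\<close>, and
  division by \<open>l\<^sup>2 \<ge> 1\<close> can only shrink the exponent.\<close>

lemma hyp_weight_ge:
  fixes x :: "real ^ 'n"
  assumes N: "CARD('n) \<ge> 2" and l: "l \<ge> 1" and x: "x \<in> hyp_ball"
  shows "exp (- 11) \<le> hyp_weight l x"
proof -
  let ?E = "rho_over_sinh (hyp_rho x) powr ((real CARD('n) - 1) / 2) * (hyp_rho x)\<^sup>2"
  have "hyp_rho x \<ge> 0"
    using x unfolding hyp_rho_def by (intro ln_ge_zero) (simp add: field_simps)
  then have "?E \<le> 11"
    using N by (intro rho_over_sinh_powr_bound) auto
  moreover have "?E / l\<^sup>2 \<le> ?E"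
    using l by (intro divide_left_mono[where b = 1 and c = ?E, simplified]) auto
  ultimately have "?E / l\<^sup>2 \<le> 11"
    by linarith
  then show ?thesis
    by (simp add: hyp_weight_def)
qed

section \<open>From the unweighted to the weighted Poincare inequality\<close>

theorem theorem1p6:
  assumes "CARD('n::finite) \<ge> 2"
  shows "\<exists>\<beta>\<^sub>0>0. \<forall>\<beta>\<ge>\<beta>\<^sub>0. \<exists>K::real. K > 0 \<and>
    (\<forall>u \<in> (hyp_test_functions :: (real ^ 'n \<Rightarrow> real) set). \<forall>l\<ge>\<beta>.
      ennreal (l\<^sup>2 / 2) *
        (\<integral>\<^sup>+ x. ennreal ((hyp_norm x (hyp_grad u x))\<^sup>2 * hyp_weight l x) \<partial>hyp_vol)
      \<ge> ennreal K *
        (INF c::real. \<integral>\<^sup>+ x. ennreal (\<bar>u x - c\<bar>\<^sup>2 * hyp_weight l x) \<partial>hyp_vol))"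
proof -
  define N where "N = CARD('n)"
  \<comment> \<open>The factors are the lower bound of the weight, the prefactor
    \<open>l\<^sup>2 / 2\<close> at \<open>l = 1\<close>, and the Poincare constant. One
    \<open>K\<close> serves every \<open>\<beta> \<ge> 1\<close>.\<close>
  define K where "K = exp (- 11) / 2 * ((real N)\<^sup>2 / 16)"
  have "K > 0"
    by (simp add: K_def N_def)
  moreover have "ennreal K *
        (INF c::real. \<integral>\<^sup>+ x. ennreal (\<bar>u x - c\<bar>\<^sup>2 * hyp_weight l x) \<partial>hyp_vol)
      \<le> ennreal (l\<^sup>2 / 2) *
        (\<integral>\<^sup>+ x. ennreal ((hyp_norm x (hyp_grad u x))\<^sup>2 * hyp_weight l x) \<partial>hyp_vol)"
    (is "_ * ?I \<le> _ * ?J")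
    if u: "u \<in> hyp_test_functions" and l: "l \<ge> 1" for u :: "real ^ 'n \<Rightarrow> real" and l
  proof -
    define IA where "IA = (\<integral>x. (if x \<in> hyp_ball then (u x)\<^sup>2 * conf_factor x ^ N else 0) \<partial>lborel)"
    define IB where "IB = (\<integral>x. (if x \<in> hyp_ball
      then (hyp_norm x (hyp_grad u x))\<^sup>2 * conf_factor x ^ N else 0) \<partial>lborel)"
    note P = hyperbolic_poincare[OF assms u]
    have IA: "(\<integral>\<^sup>+ x. ennreal ((u x)\<^sup>2) \<partial>hyp_vol) = ennreal IA"
      using P(1) unfolding IA_def N_def by (intro nn_integral_hyp_vol) auto
    \<comment> \<open>The factor \<open>exp (- 11)\<close> stays inside the integrand so that
      \<open>J\<close> below is a pointwise comparison with the weight.\<close>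
    have "integrable lborel (\<lambda>x. if x \<in> hyp_ball
      then exp (- 11) * (hyp_norm x (hyp_grad u x))\<^sup>2 * conf_factor x ^ CARD('n) else 0)"
      using integrable_mult_right[OF P(2), of "exp (- 11)"]
      by (simp add: if_distrib mult.assoc cong: if_cong)
    then have "(\<integral>\<^sup>+ x. ennreal (exp (- 11) * (hyp_norm x (hyp_grad u x))\<^sup>2) \<partial>hyp_vol)
      = ennreal (\<integral>x. (if x \<in> hyp_ball
          then exp (- 11) * (hyp_norm x (hyp_grad u x))\<^sup>2 * conf_factor x ^ CARD('n) else 0) \<partial>lborel)"
      by (intro nn_integral_hyp_vol) auto
    also have "(\<integral>x. (if x \<in> hyp_ball
          then exp (- 11) * (hyp_norm x (hyp_grad u x))\<^sup>2 * conf_factor x ^ CARD('n) else 0) \<partial>lborel)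
        = (\<integral>x. exp (- 11) * (if x \<in> hyp_ball
          then (hyp_norm x (hyp_grad u x))\<^sup>2 * conf_factor x ^ N else 0) \<partial>lborel)"
      by (intro Bochner_Integration.integral_cong) (auto simp: N_def)
    also have "\<dots> = exp (- 11) * IB"
      by (simp add: IB_def)
    finally have IB: "(\<integral>\<^sup>+ x. ennreal (exp (- 11) * (hyp_norm x (hyp_grad u x))\<^sup>2) \<partial>hyp_vol)
      = ennreal (exp (- 11) * IB)" .
    have IB0: "0 \<le> IB"
      unfolding IB_def
      by (intro integral_nonneg_AE AE_I2) (simp add: conf_factor_power_nonneg)
    have I: "?I \<le> ennreal IA"
    proof -
      have "?I \<le> (\<integral>\<^sup>+ x. ennreal (\<bar>u x - 0\<bar>\<^sup>2 * hyp_weight l x) \<partial>hyp_vol)"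
        by (rule INF_lower) simp
      also have "\<dots> \<le> (\<integral>\<^sup>+ x. ennreal ((u x)\<^sup>2) \<partial>hyp_vol)"
        using mult_left_mono[OF hyp_weight_le_1 zero_le_power2]
        by (intro nn_integral_mono ennreal_leI) simp
      finally show ?thesis
        by (simp add: IA)
    qed
    have J: "ennreal (exp (- 11) * IB) \<le> ?J"
      unfolding IB[symmetric]
    proof (intro nn_integral_mono ennreal_leI)
      fix x :: "real ^ 'n" assume "x \<in> space hyp_vol"
      then have "exp (- 11) \<le> hyp_weight l x"
        using hyp_weight_ge[OF assms l] by (simp add: hyp_vol_def space_restrict_space)
      then show "exp (- 11) * (hyp_norm x (hyp_grad u x))\<^sup>2
          \<le> (hyp_norm x (hyp_grad u x))\<^sup>2 * hyp_weight l x"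
        by (simp add: mult.commute mult_right_mono)
    qed
    have "K * IA \<le> exp (- 11) / 2 * IB"
      using mult_left_mono[OF P(3)[folded N_def, folded IA_def IB_def], of "exp (- 11) / 2"]
      by (simp add: K_def)
    \<comment> \<open>This uses \<open>l \<ge> 1\<close> together with
      \<open>IB \<ge> 0\<close>.\<close>
    also have "\<dots> \<le> l\<^sup>2 / 2 * (exp (- 11) * IB)"
      using mult_right_mono[of 1 "l\<^sup>2" "exp (- 11) * IB"] l IB0 by simp
    finally have le: "K * IA \<le> l\<^sup>2 / 2 * (exp (- 11) * IB)" .
    have "ennreal K * ?I \<le> ennreal K * ennreal IA"
      by (rule mult_left_mono[OF I]) simp
    also have "\<dots> = ennreal (K * IA)"
      using \<open>K > 0\<close> by (simp add: ennreal_mult')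
    also have "\<dots> \<le> ennreal (l\<^sup>2 / 2 * (exp (- 11) * IB))"
      by (rule ennreal_leI[OF le])
    also have "\<dots> = ennreal (l\<^sup>2 / 2) * ennreal (exp (- 11) * IB)"
      by (rule ennreal_mult') simp
    also have "\<dots> \<le> ennreal (l\<^sup>2 / 2) * ?J"
      by (rule mult_left_mono[OF J]) simp
    finally show ?thesis .
  qed
  ultimately show ?thesis
    by (intro exI[of _ 1] conjI allI impI exI[of _ K] ballI) auto
qed

end
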